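(* Let $q\ge2$, $n\ge0$ be integers and let $G$ be a $q\times q$ generalized Hadamard matrix. Then for all $p,t\in V(n,q)$, \[ \sum_{s\in V(n,q)}\frac{1}{s!}\,MG(p;s)\,\overline{MG(t;s)}=\frac{q^n}{p!}\,\delta_{p,t}, \] where $\delta_{p,t}=1$ if $p_i=t_i$ for all $i$ and $0$ otherwise.
   Context: A $q\times q$ complex matrix $H$ is a generalized Hadamard matrix if $H\overline{H}^T=qI_q$. For integers $n\ge0$, $q\ge2$, $V(n,q)=\{p=(p_0,\ldots,p_{q-1})\in\mathbb{N}_0^q : \sum_i p_i=n\}$, and $p!=\prod_{i}p_i!$. Entries of $G$ are $g_{ij}$, $i,j=0,\ldots,q-1$. For $p,s\in V(n,q)$, \[ MG(p;s)=s!\sum_{(r_{i,j})}\prod_{a=0}^{q-1}\prod_{b=0}^{q-1}\frac{g_{ab}^{r_{a,b}}}{r_{a,b}!}, \] the sum being over all families of nonnegative integers $r_{i,j}$ ($i,j=0,\ldots,q-1$) with $\sum_j r_{i,j}=s_i$ for all $i$ and $\sum_i r_{i,j}=p_j$ for all $j$ (with $0^0=1$). *)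

theory Defs
  imports Complex_Main "Jordan_Normal_Form.Matrix"
begin

definition generalized_Hadamard :: "nat \<Rightarrow> complex mat \<Rightarrow> bool" where
  "generalized_Hadamard q H \<longleftrightarrow>
     H \<in> carrier_mat q q \<and> H * transpose_mat (map_mat cnj H) = of_nat q \<cdot>\<^sub>m 1\<^sub>m q"

definition V :: "nat \<Rightarrow> nat \<Rightarrow> nat vec set" where
  "V n q = {p \<in> carrier_vec q. (\<Sum>i<q. p $ i) = n}"

definition vfact :: "nat vec \<Rightarrow> nat" where
  "vfact p = (\<Prod>i<dim_vec p. fact (p $ i))"

definition tables :: "nat \<Rightarrow> nat vec \<Rightarrow> nat vec \<Rightarrow> nat mat set" where
  "tables q p s = {r \<in> carrier_mat q q.
     (\<forall>i<q. (\<Sum>j<q. r $$ (i, j)) = s $ i) \<and> (\<forall>j<q. (\<Sum>i<q. r $$ (i, j)) = p $ j)}"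

definition MG :: "nat \<Rightarrow> complex mat \<Rightarrow> nat vec \<Rightarrow> nat vec \<Rightarrow> complex" where
  "MG q G p s = of_nat (vfact s) *
     (\<Sum>r\<in>tables q p s. \<Prod>a<q. \<Prod>b<q. G $$ (a, b) ^ (r $$ (a, b)) / fact (r $$ (a, b)))"

text \<open>Sums over infinite sets are 0 by convention; the index sets used here are finite.\<close>

lemma finite_V: "finite (V n q)"
proof (rule finite_subset)
  show "V n q \<subseteq> vec_of_list ` {xs. set xs \<subseteq> {..n} \<and> length xs = q}"
  proof
    fix p assume p: "p \<in> V n q"
    have "p $ i \<le> n" if "i < q" for i
      using p that member_le_sum[of i "{..<q}" "\<lambda>i. p $ i"] by (auto simp: V_def)
    then have "set (list_of_vec p) \<subseteq> {..n}" "length (list_of_vec p) = q"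
      using p by (auto simp: V_def set_list_of_vec vec_set_def)
    then show "p \<in> vec_of_list ` {xs. set xs \<subseteq> {..n} \<and> length xs = q}"
      by (intro image_eqI[of _ _ "list_of_vec p"]) (auto simp: vec_list)
  qed
qed (intro finite_imageI finite_lists_length_eq, simp)

lemma finite_tables: "finite (tables q p s)"
proof (rule finite_subset)
  let ?F = "({..<q} \<times> {..<q}) \<rightarrow>\<^sub>E {..(\<Sum>i<q. s $ i)}"
  show "tables q p s \<subseteq> (\<lambda>f. mat q q f) ` ?F"
  proof
    fix r assume r: "r \<in> tables q p s"
    have "r $$ (i, j) \<le> (\<Sum>i<q. s $ i)" if "i < q" "j < q" for i j
    proof -
      have "r $$ (i, j) \<le> (\<Sum>j<q. r $$ (i, j))"
        using that member_le_sum[of j "{..<q}" "\<lambda>j. r $$ (i, j)"] by simp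
      also have "\<dots> = s $ i"
        using r that by (simp add: tables_def)
      also have "\<dots> \<le> (\<Sum>i<q. s $ i)"
        using that member_le_sum[of i "{..<q}" "\<lambda>i. s $ i"] by simp
      finally show ?thesis .
    qed
    then have "restrict (\<lambda>ij. r $$ ij) ({..<q} \<times> {..<q}) \<in> ?F"
      by auto
    moreover have "r = mat q q (restrict (\<lambda>ij. r $$ ij) ({..<q} \<times> {..<q}))"
      using r by (intro eq_matI) (auto simp: tables_def)
    ultimately show "r \<in> (\<lambda>f. mat q q f) ` ?F" by blast
  qed
qed (intro finite_imageI finite_PiE, auto)

end

(* Put W(p;s) = MG(p;s)/s! and let e_i be the i-th unit vector.  Weighting every table r by its
   entry r_ij and removing one unit from that entry gives the recurrences
     p_j W(p;s) = sum_i g_ij W(p - e_j; s - e_i),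
     s_i W(p;s) = sum_j g_ij W(p - e_j; s - e_i).
   Applying the first to p and the second to t turns p_j times the sum for (p,t) into
     sum_k (sum_i g_ij cnj g_ik) * (the sum for (p - e_j, t - e_k)),
   and the columns of G are orthogonal, so only k = j survives; induct on n. *)

theory Submission
  imports Defs "Jordan_Normal_Form.Determinant"
begin

section \<open>Weighted sums over tables with given margins\<close>

definition table_weight :: "nat \<Rightarrow> complex mat \<Rightarrow> nat mat \<Rightarrow> complex" where
  "table_weight q G r = (\<Prod>a<q. \<Prod>b<q. G $$ (a, b) ^ (r $$ (a, b)) / fact (r $$ (a, b)))"

definition table_sum :: "nat \<Rightarrow> complex mat \<Rightarrow> nat vec \<Rightarrow> nat vec \<Rightarrow> complex" where
  "table_sum q G p s = (\<Sum>r\<in>tables q p s. table_weight q G r)"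

text \<open>Summing over \<open>i\<close> leads to the recurrence driven by a column margin, summing
  over \<open>j\<close> to the one driven by a row margin, so a single shift formula for this sum
  serves both.\<close>

definition entry_sum :: "nat \<Rightarrow> complex mat \<Rightarrow> nat \<Rightarrow> nat \<Rightarrow> nat vec \<Rightarrow> nat vec \<Rightarrow> complex" where
  "entry_sum q G i j p s = (\<Sum>r\<in>tables q p s. of_nat (r $$ (i, j)) * table_weight q G r)"

definition unit_mat :: "nat \<Rightarrow> nat \<Rightarrow> nat \<Rightarrow> nat mat" where
  "unit_mat q i j = mat q q (\<lambda>(a, b). if a = i \<and> b = j then 1 else 0)"

lemma MG_eq: "MG q G p s = of_nat (vfact s) * table_sum q G p s"
  by (simp add: MG_def table_sum_def table_weight_def)

lemma sum_columns_entry_sum: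
  assumes "j < q"
  shows "(\<Sum>i<q. entry_sum q G i j p s) = of_nat (p $ j) * table_sum q G p s"
proof -
  have "(\<Sum>i<q. entry_sum q G i j p s)
      = (\<Sum>r\<in>tables q p s. of_nat (\<Sum>i<q. r $$ (i, j)) * table_weight q G r)"
    unfolding entry_sum_def by (subst sum.swap) (simp add: sum_distrib_right)
  also have "\<dots> = (\<Sum>r\<in>tables q p s. of_nat (p $ j) * table_weight q G r)"
    using assms by (intro sum.cong refl) (simp add: tables_def del: of_nat_sum)
  finally show ?thesis
    by (simp add: table_sum_def sum_distrib_left)
qed

lemma sum_rows_entry_sum:
  assumes "i < q"
  shows "(\<Sum>j<q. entry_sum q G i j p s) = of_nat (s $ i) * table_sum q G p s"
proof -
  have "(\<Sum>j<q. entry_sum q G i j p s)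
      = (\<Sum>r\<in>tables q p s. of_nat (\<Sum>j<q. r $$ (i, j)) * table_weight q G r)"
    unfolding entry_sum_def by (subst sum.swap) (simp add: sum_distrib_right)
  also have "\<dots> = (\<Sum>r\<in>tables q p s. of_nat (s $ i) * table_weight q G r)"
    using assms by (intro sum.cong refl) (simp add: tables_def del: of_nat_sum)
  finally show ?thesis
    by (simp add: table_sum_def sum_distrib_left)
qed

text \<open>Covers the boundary case in which a margin cannot be lowered: an entry is bounded by its
  row sum and by its column sum.\<close>

lemma entry_sum_eq_0:
  assumes "i < q" "j < q" "p $ j = 0 \<or> s $ i = 0"
  shows "entry_sum q G i j p s = 0"
proof -
  have "r $$ (i, j) = 0" if r: "r \<in> tables q p s" for r
  proof -
    have "r $$ (i, j) \<le> (\<Sum>i<q. r $$ (i, j))"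
      using assms(1) member_le_sum[of i "{..<q}" "\<lambda>i. r $$ (i, j)"] by simp
    moreover have "r $$ (i, j) \<le> (\<Sum>j<q. r $$ (i, j))"
      using assms(2) member_le_sum[of j "{..<q}" "\<lambda>j. r $$ (i, j)"] by simp
    ultimately show ?thesis
      using r assms by (auto simp: tables_def)
  qed
  then show ?thesis by (simp add: entry_sum_def)
qed

section \<open>Removing one unit from an entry\<close>

lemma table_weight_add_unit:
  assumes "i < q" "j < q" "r \<in> carrier_mat q q"
  shows "of_nat (r $$ (i, j) + 1) * table_weight q G (r + unit_mat q i j)
    = G $$ (i, j) * table_weight q G r"
proof -
  let ?f = "\<lambda>r a b. G $$ (a, b) ^ (r $$ (a, b)) / fact (r $$ (a, b))"
  let ?r = "r + unit_mat q i j"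
  have w: "table_weight q G r' = ?f r' i j *
      ((\<Prod>b\<in>{..<q}-{j}. ?f r' i b) * (\<Prod>a\<in>{..<q}-{i}. \<Prod>b<q. ?f r' a b))" for r'
  proof -
    have "table_weight q G r' = (\<Prod>b<q. ?f r' i b) * (\<Prod>a\<in>{..<q}-{i}. \<Prod>b<q. ?f r' a b)"
      unfolding table_weight_def using assms(1) by (subst prod.remove[of _ i]) simp_all
    also have "(\<Prod>b<q. ?f r' i b) = ?f r' i j * (\<Prod>b\<in>{..<q}-{j}. ?f r' i b)"
      using assms(2) by (subst prod.remove[of _ j]) simp_all
    finally show ?thesis by (simp only: mult.assoc)
  qed
  have e: "?r $$ (a, b) = r $$ (a, b) + (if a = i \<and> b = j then 1 else 0)" if "a < q" "b < q" for a b
    using that assms by (simp add: unit_mat_def)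
  have "(\<Prod>b\<in>{..<q}-{j}. ?f ?r i b) = (\<Prod>b\<in>{..<q}-{j}. ?f r i b)"
    using assms by (intro prod.cong refl) (simp add: e)
  moreover have "(\<Prod>a\<in>{..<q}-{i}. \<Prod>b<q. ?f ?r a b) = (\<Prod>a\<in>{..<q}-{i}. \<Prod>b<q. ?f r a b)"
    by (intro prod.cong refl) (simp add: e)
  \<comment> \<open>Here (x + 1) / (x + 1)! = 1 / x!, and the raised power leaves one factor
    \<open>G $$ (i, j)\<close>. All other factors of the product are unchanged.\<close>
  moreover have "of_nat (r $$ (i, j) + 1) * ?f ?r i j = G $$ (i, j) * ?f r i j"
    using assms by (simp add: e del: of_nat_Suc)
  ultimately show ?thesis
    unfolding w by (simp only: mult.assoc[symmetric])
qed

text \<open>Adding \<open>unit_mat q i j\<close> raises exactly row sum \<open>i\<close> and column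
  sum \<open>j\<close> by one. Units are added rather than subtracted because subtraction on
  \<open>nat\<close> truncates.\<close>

lemma tables_add_unit:
  assumes "i < q" "j < q" "p \<in> carrier_vec q" "s \<in> carrier_vec q"
  shows "{r \<in> tables q (p + unit_vec q j) (s + unit_vec q i). r $$ (i, j) \<noteq> 0}
    = (\<lambda>r. r + unit_mat q i j) ` tables q p s" (is "?L = ?R")
proof (intro equalityI subsetI)
  have e: "(r + unit_mat q i j) $$ (a, b) = r $$ (a, b) + (if a = i \<and> b = j then 1 else 0)"
    if "a < q" "b < q" for r :: "nat mat" and a b
    using that by (simp add: unit_mat_def)
  have rows: "(\<Sum>b<q. (r + unit_mat q i j) $$ (a, b))
      = (\<Sum>b<q. r $$ (a, b)) + (if a = i then 1 else 0)" if "a < q" for r a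
    using that assms by (simp add: e sum.distrib)
  have cols: "(\<Sum>a<q. (r + unit_mat q i j) $$ (a, b))
      = (\<Sum>a<q. r $$ (a, b)) + (if b = j then 1 else 0)" if "b < q" for r b
    using that assms by (simp add: e sum.distrib)
  {
    fix r assume r: "r \<in> ?L"
    \<comment> \<open>The truncated subtraction is exact here, since \<open>r\<close> has a nonzero
      entry at \<open>(i, j)\<close>.\<close>
    define r' where "r' = mat q q (\<lambda>(a, b). r $$ (a, b) - (if a = i \<and> b = j then 1 else 0))"
    have rr': "r = r' + unit_mat q i j"
      using r by (intro eq_matI) (auto simp: r'_def unit_mat_def tables_def)
    have "r' \<in> tables q p s"
      unfolding tables_def
    proof (intro CollectI conjI allI impI)
      show "r' \<in> carrier_mat q q" by (simp add: r'_def)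
    next
      fix a assume "a < q"
      then show "(\<Sum>b<q. r' $$ (a, b)) = s $ a"
        using r rows[of a r'] assms unfolding rr'[symmetric]
        by (auto simp: tables_def unit_vec_def split: if_splits)
    next
      fix b assume "b < q"
      then show "(\<Sum>a<q. r' $$ (a, b)) = p $ b"
        using r cols[of b r'] assms unfolding rr'[symmetric]
        by (auto simp: tables_def unit_vec_def split: if_splits)
    qed
    with rr' show "r \<in> ?R" by blast
  next
    fix r assume "r \<in> ?R"
    then obtain r' where r': "r' \<in> tables q p s" "r = r' + unit_mat q i j" by blast
    have "r \<in> carrier_mat q q" using r' by (simp add: tables_def unit_mat_def)
    moreover have "r $$ (i, j) \<noteq> 0" using assms by (simp add: r' e)
    ultimately show "r \<in> ?L"
      using r' assms by (auto simp: tables_def rows cols unit_vec_def)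
  }
qed

text \<open>Tables with a zero at \<open>(i, j)\<close> contribute nothing. The others correspond
  bijectively to the tables with the lower margins, and \<open>table_weight_add_unit\<close>
  compares the weights.\<close>

lemma entry_sum_add_unit:
  assumes "i < q" "j < q" "p \<in> carrier_vec q" "s \<in> carrier_vec q"
  shows "entry_sum q G i j (p + unit_vec q j) (s + unit_vec q i) = G $$ (i, j) * table_sum q G p s"
proof -
  let ?T = "tables q (p + unit_vec q j) (s + unit_vec q i)"
  have inj: "inj_on (\<lambda>r. r + unit_mat q i j) (tables q p s)"
  proof (rule inj_onI)
    fix r r' assume r: "r \<in> tables q p s" "r' \<in> tables q p s"
      and eq: "r + unit_mat q i j = r' + unit_mat q i j"
    show "r = r'"
    proof (rule eq_matI)
      fix a b assume "a < dim_row r'" "b < dim_col r'"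
      with r have "a < q" "b < q" by (auto simp: tables_def)
      with arg_cong[OF eq, of "\<lambda>r. r $$ (a, b)"] show "r $$ (a, b) = r' $$ (a, b)"
        by (simp add: unit_mat_def)
    qed (use r in \<open>auto simp: tables_def\<close>)
  qed
  have "entry_sum q G i j (p + unit_vec q j) (s + unit_vec q i)
      = (\<Sum>r\<in>{r \<in> ?T. r $$ (i, j) \<noteq> 0}. of_nat (r $$ (i, j)) * table_weight q G r)"
    unfolding entry_sum_def by (rule sum.mono_neutral_right) (auto simp: finite_tables)
  also have "\<dots> = (\<Sum>r\<in>tables q p s. G $$ (i, j) * table_weight q G r)"
    unfolding tables_add_unit[OF assms] sum.reindex[OF inj] o_def
  proof (rule sum.cong[OF refl])
    fix r assume "r \<in> tables q p s"
    then have "r \<in> carrier_mat q q" by (simp add: tables_def)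
    moreover have "(r + unit_mat q i j) $$ (i, j) = r $$ (i, j) + 1"
      using assms by (simp add: unit_mat_def)
    ultimately show "of_nat ((r + unit_mat q i j) $$ (i, j)) * table_weight q G (r + unit_mat q i j)
        = G $$ (i, j) * table_weight q G r"
      using table_weight_add_unit[OF assms(1,2)] by metis
  qed
  finally show ?thesis by (simp add: table_sum_def sum_distrib_left)
qed

section \<open>Shifting index vectors by a unit vector\<close>

lemma ex_add_unit_vec:
  assumes "p \<in> carrier_vec q" "j < q" "p $ j \<noteq> (0::nat)"
  obtains p' where "p' \<in> carrier_vec q" "p = p' + unit_vec q j"
proof
  show "vec q (\<lambda>i. p $ i - (if i = j then 1 else 0)) \<in> carrier_vec q" by simp
  show "p = vec q (\<lambda>i. p $ i - (if i = j then 1 else 0)) + unit_vec q j"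
    using assms by (intro eq_vecI) (auto simp: unit_vec_def)
qed

lemma add_unit_vec_in_V_iff:
  assumes "p \<in> carrier_vec q" "j < q"
  shows "p + unit_vec q j \<in> V (Suc n) q \<longleftrightarrow> p \<in> V n q"
  using assms by (simp add: V_def unit_vec_def sum.distrib)

text \<open>Serves to reindex a sum over \<open>s\<close> once the terms with
  \<open>s $ i = 0\<close> have dropped out.\<close>

lemma V_Suc_pos:
  assumes "i < q"
  shows "{s \<in> V (Suc n) q. s $ i \<noteq> 0} = (\<lambda>s. s + unit_vec q i) ` V n q"
proof (intro equalityI subsetI)
  fix s assume s: "s \<in> {s \<in> V (Suc n) q. s $ i \<noteq> 0}"
  then obtain s' where "s' \<in> carrier_vec q" "s = s' + unit_vec q i"
    using ex_add_unit_vec[of s q i] assms by (auto simp: V_def)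
  with s show "s \<in> (\<lambda>s. s + unit_vec q i) ` V n q"
    using add_unit_vec_in_V_iff assms by blast
next
  fix s assume "s \<in> (\<lambda>s. s + unit_vec q i) ` V n q"
  then obtain s' where s': "s' \<in> V n q" "s = s' + unit_vec q i" by blast
  then have "s' \<in> carrier_vec q" by (simp add: V_def)
  with s' show "s \<in> {s \<in> V (Suc n) q. s $ i \<noteq> 0}"
    using assms by (simp add: add_unit_vec_in_V_iff)
qed

lemma inj_on_add_unit_vec: "inj_on (\<lambda>s::nat vec. s + unit_vec q i) (carrier_vec q)"
proof (rule inj_onI)
  fix s s' :: "nat vec" assume s: "s \<in> carrier_vec q" "s' \<in> carrier_vec q"
    and eq: "s + unit_vec q i = s' + unit_vec q i"
  show "s = s'"
  proof (rule eq_vecI)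
    fix a assume "a < dim_vec s'"
    with arg_cong[OF eq, of "\<lambda>s. s $ a"] show "s $ a = s' $ a"
      using s by simp
  qed (use s in auto)
qed

text \<open>The factor \<open>s $ i + 1\<close> is the one that the row recurrence for
  \<open>t\<close> needs at the shifted vector.\<close>

lemma vfact_add_unit_vec:
  assumes "s \<in> carrier_vec q" "i < q"
  shows "vfact (s + unit_vec q i) = (s $ i + 1) * vfact s"
proof -
  have "(\<Prod>a\<in>{..<q}-{i}. fact ((s + unit_vec q i) $ a)) = (\<Prod>a\<in>{..<q}-{i}. fact (s $ a) :: nat)"
    using assms by (intro prod.cong refl) auto
  moreover have "vfact r = fact (r $ i) * (\<Prod>a\<in>{..<q}-{i}. fact (r $ a))"
    if "r \<in> carrier_vec q" for r
    using that assms(2) unfolding vfact_def by (subst prod.remove[of _ i]) simp_all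
  ultimately show ?thesis
    using assms by (simp add: algebra_simps)
qed

section \<open>Orthogonality of the columns\<close>

lemma generalized_Hadamard_columns:
  assumes "generalized_Hadamard q G" "j < q" "k < q"
  shows "(\<Sum>i<q. G $$ (i, j) * cnj (G $$ (i, k))) = (if j = k then of_nat q else 0)"
proof -
  define H where "H = transpose_mat (map_mat cnj G)"
  have G: "G \<in> carrier_mat q q" and GH: "G * H = of_nat q \<cdot>\<^sub>m 1\<^sub>m q"
    using assms by (auto simp: generalized_Hadamard_def H_def)
  then have H: "H \<in> carrier_mat q q" by (simp add: H_def)
  have q: "(of_nat q :: complex) \<noteq> 0" using assms by simp
  \<comment> \<open>Divided by \<open>q\<close>, the matrix \<open>H\<close> is a right inverse of
    \<open>G\<close>. For square matrices it is then also a left inverse, which turns the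
    orthogonality of rows in the hypothesis into that of columns.\<close>
  have "G * (inverse (of_nat q) \<cdot>\<^sub>m H) = inverse (of_nat q) \<cdot>\<^sub>m (G * H)"
    using G H by (rule mult_smult_distrib)
  also have "\<dots> = 1\<^sub>m q" using q by (intro eq_matI) (auto simp: GH)
  finally have "(inverse (of_nat q) \<cdot>\<^sub>m H) * G = 1\<^sub>m q"
    using mat_mult_left_right_inverse[OF G] H by simp
  then have "inverse (of_nat q) \<cdot>\<^sub>m (H * G) = 1\<^sub>m q"
    by (simp only: mult_smult_assoc_mat[OF H G])
  from arg_cong[OF this, of "\<lambda>A. A $$ (k, j)"]
  have "inverse (of_nat q) * (H * G) $$ (k, j) = (if j = k then 1 else 0)"
    using assms(2,3) G H by auto
  then have "(H * G) $$ (k, j) = (if j = k then of_nat q else 0)"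
    using q by (auto simp: inverse_eq_divide divide_eq_eq split: if_splits)
  moreover have "(H * G) $$ (k, j) = (\<Sum>i<q. G $$ (i, j) * cnj (G $$ (i, k)))"
    using assms(2,3) G H
    by (auto simp: scalar_prod_def H_def atLeast0LessThan mult.commute intro!: sum.cong)
  ultimately show ?thesis by simp
qed

section \<open>The recurrence for the sum over s\<close>

definition pairing :: "nat \<Rightarrow> complex mat \<Rightarrow> nat \<Rightarrow> nat vec \<Rightarrow> nat vec \<Rightarrow> complex" where
  "pairing q G n p t =
     (\<Sum>s\<in>V n q. of_nat (vfact s) * table_sum q G p s * cnj (table_sum q G t s))"

text \<open>\<open>t' k\<close> stands for \<open>t\<close> lowered by \<open>unit_vec q k\<close>.
  It is supplied as a function because the row recurrence involves all \<open>k\<close>, although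
  only \<open>k = j\<close> survives orthogonality.\<close>

lemma pairing_add_unit_vec:
  assumes G: "generalized_Hadamard q G"
    and p: "p \<in> carrier_vec q" and j: "j < q"
    and h: "\<And>k. k < q \<Longrightarrow> t $ k \<noteq> 0 \<Longrightarrow> t' k \<in> carrier_vec q \<and> t = t' k + unit_vec q k"
  shows "of_nat (p $ j + 1) * pairing q G (Suc n) (p + unit_vec q j) t
    = (if t $ j = 0 then 0 else of_nat q * pairing q G n p (t' j))"
proof -
  let ?e = "unit_vec q :: nat \<Rightarrow> nat vec"
  let ?W = "table_sum q G" and ?T = "entry_sum q G"
  \<comment> \<open>The value 0 stands in for the missing predecessor when \<open>t $ k = 0\<close>.
    With it the shift formula \<open>T\<close> holds for every \<open>k < q\<close>, and sums over
    \<open>k\<close> need no restriction.\<close>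
  define X where "X k s = (if t $ k = 0 then 0 else ?W (t' k) s)" for k s
  have T: "?T i k t (s + ?e i) = G $$ (i, k) * X k s"
    if "i < q" "k < q" "s \<in> carrier_vec q" for i k s
  proof (cases "t $ k = 0")
    case True
    then show ?thesis using that by (simp add: X_def entry_sum_eq_0)
  next
    case False
    then show ?thesis
      using h[OF that(2) False] entry_sum_add_unit[OF that(1,2) _ that(3), of "t' k" G]
      by (simp add: X_def)
  qed
  \<comment> \<open>The shift of \<open>s\<close> depends on \<open>i\<close>, so the sum over
    \<open>s\<close> is transformed for each \<open>i\<close> separately.\<close>
  have step: "(\<Sum>s\<in>V (Suc n) q. of_nat (vfact s) * ?T i j (p + ?e j) s * cnj (?W t s))
      = (\<Sum>s\<in>V n q. of_nat (vfact s) * ?W p s *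
           (\<Sum>k<q. G $$ (i, j) * cnj (G $$ (i, k)) * cnj (X k s)))" if i: "i < q" for i
  proof -
    have inj: "inj_on (\<lambda>s. s + ?e i) (V n q)"
      using inj_on_add_unit_vec by (rule inj_on_subset) (auto simp: V_def)
    \<comment> \<open>Terms with \<open>s $ i = 0\<close> vanish by \<open>entry_sum_eq_0\<close>;
      the rest are reindexed by \<open>s + ?e i\<close>.\<close>
    have "(\<Sum>s\<in>V (Suc n) q. of_nat (vfact s) * ?T i j (p + ?e j) s * cnj (?W t s))
        = (\<Sum>s\<in>{s\<in>V (Suc n) q. s $ i \<noteq> 0}.
             of_nat (vfact s) * ?T i j (p + ?e j) s * cnj (?W t s))"
      using i j by (intro sum.mono_neutral_right) (auto simp: finite_V entry_sum_eq_0)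
    also have "\<dots> = (\<Sum>s\<in>V n q. of_nat (vfact s) * ?W p s *
           (\<Sum>k<q. G $$ (i, j) * cnj (G $$ (i, k)) * cnj (X k s)))"
      unfolding V_Suc_pos[OF i] sum.reindex[OF inj] o_def
    proof (rule sum.cong[OF refl])
      fix s assume "s \<in> V n q"
      then have s: "s \<in> carrier_vec q" by (simp add: V_def)
      \<comment> \<open>Row recurrence for \<open>t\<close>, read at the shifted vector, whose
        component \<open>i\<close> is \<open>s $ i + 1\<close>.\<close>
      have "of_nat ((s + ?e i) $ i) * ?W t (s + ?e i) = (\<Sum>k<q. G $$ (i, k) * X k s)"
        unfolding sum_rows_entry_sum[OF i, symmetric] using T i s by simp
      then have "of_nat (s $ i + 1) * ?W t (s + ?e i) = (\<Sum>k<q. G $$ (i, k) * X k s)"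
        using s i by simp
      from arg_cong[OF this, of cnj]
      have row: "of_nat (s $ i + 1) * cnj (?W t (s + ?e i))
          = (\<Sum>k<q. cnj (G $$ (i, k)) * cnj (X k s))"
        by (simp del: of_nat_add of_nat_Suc)
      \<comment> \<open>The factorial of the shifted vector splits off the factor
        \<open>s $ i + 1\<close> that occurs in \<open>row\<close>.\<close>
      have "of_nat (vfact (s + ?e i)) * ?T i j (p + ?e j) (s + ?e i) * cnj (?W t (s + ?e i))
          = of_nat (vfact s) * ?W p s *
             (G $$ (i, j) * (of_nat (s $ i + 1) * cnj (?W t (s + ?e i))))"
        unfolding vfact_add_unit_vec[OF s i] entry_sum_add_unit[OF i j p s]
        by (simp only: of_nat_mult mult_ac)
      then show "of_nat (vfact (s + ?e i)) * ?T i j (p + ?e j) (s + ?e i) * cnj (?W t (s + ?e i))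
          = of_nat (vfact s) * ?W p s * (\<Sum>k<q. G $$ (i, j) * cnj (G $$ (i, k)) * cnj (X k s))"
        unfolding row by (simp only: sum_distrib_left mult.assoc)
    qed
    finally show ?thesis .
  qed
  have pj: "(p + ?e j) $ j = p $ j + 1" using p j by simp
  have "of_nat (p $ j + 1) * pairing q G (Suc n) (p + ?e j) t
      = (\<Sum>s\<in>V (Suc n) q. of_nat (vfact s) * (\<Sum>i<q. ?T i j (p + ?e j) s) * cnj (?W t s))"
    unfolding sum_columns_entry_sum[OF j] pj pairing_def sum_distrib_left
    by (simp only: mult_ac)
  also have "\<dots> = (\<Sum>i<q. \<Sum>s\<in>V (Suc n) q.
      of_nat (vfact s) * ?T i j (p + ?e j) s * cnj (?W t s))"
    by (subst sum.swap) (simp only: sum_distrib_left sum_distrib_right)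
  also have "\<dots> = (\<Sum>i<q. \<Sum>s\<in>V n q. of_nat (vfact s) * ?W p s *
           (\<Sum>k<q. G $$ (i, j) * cnj (G $$ (i, k)) * cnj (X k s)))"
    using step by simp
  also have "\<dots> = (\<Sum>s\<in>V n q. of_nat (vfact s) * ?W p s *
           (\<Sum>i<q. \<Sum>k<q. G $$ (i, j) * cnj (G $$ (i, k)) * cnj (X k s)))"
    by (subst sum.swap) (simp only: sum_distrib_left)
  also have "\<dots> = (\<Sum>s\<in>V n q. of_nat (vfact s) * ?W p s * (of_nat q * cnj (X j s)))"
  proof (rule sum.cong[OF refl])
    fix s
    \<comment> \<open>Summing over \<open>i\<close> first produces the inner products of columns
      \<open>j\<close> and \<open>k\<close>.\<close>
    have "(\<Sum>i<q. \<Sum>k<q. G $$ (i, j) * cnj (G $$ (i, k)) * cnj (X k s))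
        = (\<Sum>k<q. (\<Sum>i<q. G $$ (i, j) * cnj (G $$ (i, k))) * cnj (X k s))"
      by (subst sum.swap) (simp only: sum_distrib_right)
    also have "\<dots> = (\<Sum>k<q. if k = j then of_nat q * cnj (X j s) else 0)"
      using generalized_Hadamard_columns[OF G j] by (intro sum.cong refl) auto
    also have "\<dots> = of_nat q * cnj (X j s)" using j by simp
    finally show "of_nat (vfact s) * ?W p s *
           (\<Sum>i<q. \<Sum>k<q. G $$ (i, j) * cnj (G $$ (i, k)) * cnj (X k s))
        = of_nat (vfact s) * ?W p s * (of_nat q * cnj (X j s))" by simp
  qed
  also have "\<dots> = (if t $ j = 0 then 0 else of_nat q * pairing q G n p (t' j))"
    by (auto simp: X_def pairing_def sum_distrib_left mult_ac)
  finally show ?thesis .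
qed

section \<open>Induction on n\<close>

lemma V_0: "V 0 q = {0\<^sub>v q}"
  by (auto simp: V_def intro!: eq_vecI)

lemma tables_0: "tables q (0\<^sub>v q) (0\<^sub>v q) = {0\<^sub>m q q}"
  by (auto simp: tables_def intro!: eq_matI)

lemma pairing_eq:
  assumes G: "generalized_Hadamard q G"
  shows "p \<in> V n q \<Longrightarrow> t \<in> V n q \<Longrightarrow>
    pairing q G n p t = of_nat q ^ n / of_nat (vfact p) * (if p = t then 1 else 0)"
proof (induction n arbitrary: p t)
  case 0
  \<comment> \<open>Only the zero vector and the zero table occur, with weight 1, so both sides
    equal 1.\<close>
  then show ?case
    by (simp add: V_0 pairing_def table_sum_def tables_0 table_weight_def vfact_def)
next
  case (Suc n)
  from Suc.prems have pt: "p \<in> carrier_vec q" "t \<in> carrier_vec q" by (simp_all add: V_def)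
  \<comment> \<open>The components of \<open>p\<close> sum to \<open>Suc n\<close>, so at least one
    can be lowered.\<close>
  have "\<exists>j<q. p $ j \<noteq> 0"
  proof (rule ccontr)
    assume "\<not> ?thesis"
    then have "(\<Sum>j<q. p $ j) = 0" by simp
    with Suc.prems show False by (simp add: V_def)
  qed
  then obtain j where j: "j < q" "p $ j \<noteq> 0" by blast
  then obtain p' where p': "p' \<in> carrier_vec q" "p = p' + unit_vec q j"
    using ex_add_unit_vec pt by blast
  \<comment> \<open>The conditions on \<open>k\<close> stand under the quantifier, so that choice
    yields a total function \<open>t'\<close>.\<close>
  have "\<exists>t'. k < q \<longrightarrow> t $ k \<noteq> 0 \<longrightarrow> t' \<in> carrier_vec q \<and> t = t' + unit_vec q k" for k
    using ex_add_unit_vec pt by metis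
  then obtain t' where
    t': "\<And>k. k < q \<Longrightarrow> t $ k \<noteq> 0 \<Longrightarrow> t' k \<in> carrier_vec q \<and> t = t' k + unit_vec q k"
    by metis
  have rec: "of_nat (p' $ j + 1) * pairing q G (Suc n) p t
      = (if t $ j = 0 then 0 else of_nat q * pairing q G n p' (t' j))"
    unfolding p'(2) by (rule pairing_add_unit_vec[OF G p'(1) j(1) t'])
  have nz: "of_nat (p' $ j + 1) \<noteq> (0 :: complex)"
    by (simp del: of_nat_add of_nat_Suc)
  show ?case
  proof (cases "t $ j = 0")
    case True
    \<comment> \<open>The recurrence gives 0, as it should: \<open>p\<close> and \<open>t\<close>
      differ in component \<open>j\<close>.\<close>
    with rec nz have "pairing q G (Suc n) p t = 0" by (simp only: if_True mult_eq_0_iff simp_thms)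
    moreover have "p \<noteq> t" using True j(2) by metis
    ultimately show ?thesis by simp
  next
    case False
    with t' j have t'j: "t' j \<in> carrier_vec q" "t = t' j + unit_vec q j" by auto
    have "p' \<in> V n q" "t' j \<in> V n q"
      using Suc.prems p' t'j add_unit_vec_in_V_iff[OF _ j(1)] by metis+
    then have IH: "pairing q G n p' (t' j)
        = of_nat q ^ n / of_nat (vfact p') * (if p' = t' j then 1 else 0)"
      by (rule Suc.IH)
    \<comment> \<open>Adding \<open>unit_vec q j\<close> is injective, so the deltas for the
      original and the lowered vectors agree.\<close>
    have eq: "p = t \<longleftrightarrow> p' = t' j"
      using inj_on_add_unit_vec[of q j] p' t'j by (auto dest: inj_onD)
    \<comment> \<open>The factor that the recurrence divides by is exactly the quotient of the two
      factorials.\<close>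
    have vp: "vfact p = (p' $ j + 1) * vfact p'"
      unfolding p'(2) by (rule vfact_add_unit_vec[OF p'(1) j(1)])
    have "pairing q G (Suc n) p t = of_nat q * pairing q G n p' (t' j) / of_nat (p' $ j + 1)"
      using rec nz False by (simp add: eq_divide_eq mult.commute del: of_nat_add of_nat_Suc)
    then show ?thesis
      unfolding IH eq vp of_nat_mult by (simp del: of_nat_add of_nat_Suc add: mult_ac)
  qed
qed

theorem mainTheorem2:
  fixes q n :: nat and G :: "complex mat" and p t :: "nat vec"
  assumes "q \<ge> 2"
    and "generalized_Hadamard q G"
    and "p \<in> V n q" and "t \<in> V n q"
  shows "(\<Sum>s\<in>V n q. 1 / of_nat (vfact s) * MG q G p s * cnj (MG q G t s)) =
    of_nat q ^ n / of_nat (vfact p) * (if \<forall>i<q. p $ i = t $ i then 1 else 0)"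
proof -
  \<comment> \<open>Each \<open>MG\<close> carries a factor s!; one of the two cancels against 1/s!,
    which leaves the summand of \<open>pairing\<close>.\<close>
  have "vfact s \<noteq> 0" for s by (simp add: vfact_def)
  then have "1 / of_nat (vfact s) * MG q G p s * cnj (MG q G t s)
      = of_nat (vfact s) * table_sum q G p s * cnj (table_sum q G t s)" for s
    by (simp add: MG_eq)
  then have "(\<Sum>s\<in>V n q. 1 / of_nat (vfact s) * MG q G p s * cnj (MG q G t s)) = pairing q G n p t"
    by (simp only: pairing_def)
  moreover have "p \<in> carrier_vec q" "t \<in> carrier_vec q"
    using assms(3,4) by (simp_all add: V_def)
  then have "(\<forall>i<q. p $ i = t $ i) \<longleftrightarrow> p = t"
    by (metis carrier_vecD eq_vecI)
  ultimately show ?thesis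
    using pairing_eq[OF assms(2-4)] by (simp only:)
qed

end
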